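(* Let $\lambda(z)\,|dz|$ be a conformal pseudometric on the unit disk $\mathbb{D}$ with curvature $\kappa_\lambda\le -4$. Suppose that $$\frac{\lambda(z_n)}{\lambda_{\mathbb{D}}(z_n)}=1+o\big((1-|z_n|)^2\big)$$ for some sequence $(z_n)$ in $\mathbb{D}$ such that $|z_n|\to 1$. Then $\lambda=\lambda_{\mathbb{D}}$.
   Context: $\mathbb{D}=\{z\in\mathbb{C}:|z|<1\}$ and $\lambda_{\mathbb{D}}(z)=\frac{1}{1-|z|^2}$. A conformal pseudometric $\lambda(z)\,|dz|$ on a domain $G\subset\mathbb{C}$ is a continuous function $\lambda:G\to[0,\infty)$ which is of class $C^2$ on $\{z\in G:\lambda(z)>0\}$; its curvature is $\kappa_\lambda(z)=-\Delta(\log\lambda)(z)/\lambda(z)^2$, defined at all $z$ with $\lambda(z)>0$ ($\Delta$ the standard Laplacian). $\kappa_\lambda\le -4$ means $\kappa_\lambda(z)\le -4$ for all $z$ with $\lambda(z)>0$. *)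

theory Defs
  imports "HOL-Complex_Analysis.Complex_Analysis" "HOL-Library.Landau_Symbols"
begin

text \<open>
  Twice continuously differentiable in the sense of real Frechet derivatives; for \<open>'a = complex\<close>
  this is real (not complex) differentiability. It is meant for open \<open>S\<close>.
\<close>
definition C2_on :: "'a::real_normed_vector set \<Rightarrow> ('a \<Rightarrow> 'b::real_normed_vector) \<Rightarrow> bool" where
  "C2_on S f \<longleftrightarrow>
     (\<exists>(f' :: 'a \<Rightarrow> 'a \<Rightarrow>\<^sub>L 'b) (f'' :: 'a \<Rightarrow> 'a \<Rightarrow>\<^sub>L 'a \<Rightarrow>\<^sub>L 'b).
        (\<forall>z\<in>S. (f has_derivative blinfun_apply (f' z)) (at z)) \<and>
        (\<forall>z\<in>S. (f' has_derivative blinfun_apply (f'' z)) (at z)) \<and>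
        continuous_on S f'')"

definition partial_x :: "(complex \<Rightarrow> real) \<Rightarrow> complex \<Rightarrow> real" where
  "partial_x u z = deriv (\<lambda>t::real. u (z + of_real t)) 0"

definition partial_y :: "(complex \<Rightarrow> real) \<Rightarrow> complex \<Rightarrow> real" where
  "partial_y u z = deriv (\<lambda>t::real. u (z + \<i> * of_real t)) 0"

definition laplacian :: "(complex \<Rightarrow> real) \<Rightarrow> complex \<Rightarrow> real" where
  "laplacian u z = partial_x (partial_x u) z + partial_y (partial_y u) z"

definition conformal_pseudometric :: "complex set \<Rightarrow> (complex \<Rightarrow> real) \<Rightarrow> bool" where
  "conformal_pseudometric G \<rho> \<longleftrightarrow>
     open G \<and> connected G \<and> G \<noteq> {} \<and>
     (\<forall>z\<in>G. 0 \<le> \<rho> z) \<and> continuous_on G \<rho> \<and> C2_on {z \<in> G. \<rho> z > 0} \<rho>"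

text \<open>
  Only meaningful at points with \<open>\<rho> z > 0\<close>. There \<open>\<rho>\<close> is positive on a neighbourhood, so the
  value of \<^term>\<open>ln\<close> at non-positive arguments does not matter.
\<close>
definition curvature :: "(complex \<Rightarrow> real) \<Rightarrow> complex \<Rightarrow> real" where
  "curvature \<rho> z = - laplacian (\<lambda>w. ln (\<rho> w)) z / (\<rho> z)\<^sup>2"

definition curvature_le :: "complex set \<Rightarrow> (complex \<Rightarrow> real) \<Rightarrow> real \<Rightarrow> bool" where
  "curvature_le G \<rho> c \<longleftrightarrow> (\<forall>z\<in>G. \<rho> z > 0 \<longrightarrow> curvature \<rho> z \<le> c)"

abbreviation unit_disk :: "complex set" where
  "unit_disk \<equiv> ball 0 1"

text \<open>The Poincare metric, normalised to have curvature \<open>-4\<close>.\<close>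
definition disk_metric :: "complex \<Rightarrow> real" where
  "disk_metric z = 1 / (1 - (norm z)\<^sup>2)"

end

theory Submission imports Defs begin

text \<open>
  Write \<open>\<lambda>\<close> for the Poincare metric and \<open>M = 1 - |z|\<^sup>2\<close>, so \<open>\<lambda> = 1 / M\<close>. By Ahlfors' lemma
  \<open>v = ln (\<lambda> / \<rho>) \<ge> 0\<close>, and the curvature bound gives \<open>\<Delta> v \<le> 8 \<lambda>\<^sup>2 v\<close>. If \<open>v > 0\<close> near some
  point \<open>a\<close>, compare \<open>v\<close> with a Hopf-type barrier \<open>\<psi> = M\<^sup>2 exp (- K |z - a|\<^sup>2)\<close>: for large \<open>K\<close> it
  satisfies \<open>\<Delta> \<psi> \<ge> 8 \<lambda>\<^sup>2 \<psi>\<close> off a small disk around \<open>a\<close> and vanishes on the unit circle, so the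
  minimum principle yields \<open>v \<ge> \<epsilon> \<psi>\<close> there. Since \<open>\<psi>\<close> is bounded below by a multiple of
  \<open>(1 - |z|)\<^sup>2\<close>, the error term \<open>o((1 - |z\<^sub>n|)\<^sup>2)\<close> is impossible.
\<close>

section \<open>Second-order conditions at a local maximum\<close>

text \<open>Since \<open>h' 0 = 0\<close>, a positive \<open>D\<close> would make \<open>h'\<close>
  positive just to the right of \<open>0\<close>, and \<open>h\<close> would rise above its
  maximum.\<close>

lemma local_max_second_deriv_nonpos:
  fixes h h' :: "real \<Rightarrow> real"
  assumes e: "e > 0"
    and h: "\<And>t. \<bar>t\<bar> < e \<Longrightarrow> (h has_real_derivative h' t) (at t)"
    and h': "(h' has_real_derivative D) (at 0)"
    and max: "\<And>t. \<bar>t\<bar> < e \<Longrightarrow> h t \<le> h 0"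
  shows "D \<le> 0"
proof (rule ccontr)
  assume "\<not> D \<le> 0"
  have "h' 0 = 0"
    using DERIV_local_max[OF h[of 0] e] e max by simp
  with DERIV_pos_inc_right[OF h'] \<open>\<not> D \<le> 0\<close>
  obtain d where d: "d > 0" "\<And>t. 0 < t \<Longrightarrow> t < d \<Longrightarrow> 0 < h' t" by auto
  define s where "s = min d e / 2"
  have s: "0 < s" "s < d" "s < e" using d e by (auto simp: s_def)
  have "h 0 < h s"
  proof (rule DERIV_pos_imp_increasing_open[OF s(1)])
    fix x assume "0 < x" "x < s"
    then show "\<exists>y. (h has_real_derivative y) (at x) \<and> 0 < y"
      using h[of x] d(2)[of x] s by (intro exI[of _ "h' x"]) auto
    next
    show "continuous_on {0..s} h"
      using h s by (intro DERIV_atLeastAtMost_imp_continuous_on) (force intro: exI)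
  qed
  then show False using max[of s] s by simp
qed

text \<open>\<open>k w\<close> is the derivative of \<open>ln \<rho>\<close> at \<open>w\<close> in
  direction \<open>d\<close>. The version at \<open>0\<close> with moving base point
  \<open>w\<close> matches the nested difference quotients of \<open>partial_x\<close> and
  \<open>partial_y\<close>; the version at \<open>t\<close> with fixed base point \<open>z\<close>
  serves the one-variable second derivative test.\<close>

lemma C2_on_line_derivs:
  fixes \<rho> :: "complex \<Rightarrow> real"
  assumes C2: "C2_on S \<rho>" and S: "open S" "z \<in> S" and pos: "\<And>w. w \<in> S \<Longrightarrow> \<rho> w > 0"
    and d: "norm d = 1"
  obtains e k where "e > 0" "\<And>t. \<bar>t\<bar> < e \<Longrightarrow> z + d * of_real t \<in> S"
    "\<And>w. w \<in> S \<Longrightarrow> ((\<lambda>t::real. ln (\<rho> (w + d * of_real t))) has_real_derivative k w) (at 0)"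
    "\<And>t. \<bar>t\<bar> < e \<Longrightarrow>
        ((\<lambda>t::real. ln (\<rho> (z + d * of_real t))) has_real_derivative k (z + d * of_real t)) (at t)"
    "(\<lambda>t::real. k (z + d * of_real t)) differentiable (at 0)"
proof -
  from C2 obtain f' :: "complex \<Rightarrow> complex \<Rightarrow>\<^sub>L real" and f''
    where f': "\<And>z. z \<in> S \<Longrightarrow> (\<rho> has_derivative blinfun_apply (f' z)) (at z)"
      and f'': "\<And>z. z \<in> S \<Longrightarrow> (f' has_derivative blinfun_apply (f'' z)) (at z)"
    unfolding C2_on_def by blast
  from S obtain e where e: "e > 0" "ball z e \<subseteq> S" by (meson open_contains_ball)
  have inS: "z + d * of_real t \<in> S" if "\<bar>t\<bar> < e" for t
    using that e d by (auto simp: dist_norm norm_mult intro!: subsetD[OF e(2)])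
  define k where "k w = blinfun_apply (f' w) d / \<rho> w" for w
  have line: "((\<lambda>t::real. w + d * of_real t) has_derivative (\<lambda>t. t *\<^sub>R d)) (at s)" for w s
    by (auto intro!: derivative_eq_intros simp: scaleR_conv_of_real mult.commute)
  have der: "((\<lambda>t::real. \<rho> (w + d * of_real t)) has_real_derivative f' (w + d * of_real s) d) (at s)"
    if "w + d * of_real s \<in> S" for w s
  proof -
    have "((\<lambda>t::real. \<rho> (w + d * of_real t)) has_derivative (\<lambda>t. f' (w + d * of_real s) (t *\<^sub>R d))) (at s)"
      using has_derivative_compose[OF line f'[OF that]] .
    then show ?thesis
      by (simp add: has_field_derivative_def blinfun.scaleR_right mult.commute[of _ "blinfun_apply _ _"])
  qed
  have kder: "((\<lambda>t::real. ln (\<rho> (w + d * of_real t))) has_real_derivative k (w + d * of_real s)) (at s)"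
    if "w + d * of_real s \<in> S" for w s
    using der[OF that] pos[OF that] unfolding k_def
    by (auto intro!: derivative_eq_intros simp: field_simps)
  have "((\<lambda>t::real. f' (z + d * of_real t)) has_derivative (\<lambda>t. f'' z (t *\<^sub>R d))) (at 0)"
    using has_derivative_compose[OF line[of z 0], of f' "f'' z"] f''[OF S(2)] by simp
  then have "((\<lambda>t::real. f' (z + d * of_real t) d) has_derivative (\<lambda>t. f'' z (t *\<^sub>R d) d)) (at 0)"
    by (auto intro!: derivative_eq_intros)
  then have 1: "(\<lambda>t::real. f' (z + d * of_real t) d) differentiable (at 0)"
    by (auto simp: differentiable_def)
  have 2: "(\<lambda>t::real. \<rho> (z + d * of_real t)) differentiable (at 0)"
    using der[of z 0] S by (auto simp: real_differentiable_def)
  have "(\<lambda>t::real. k (z + d * of_real t)) differentiable (at 0)"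
    unfolding k_def using pos[OF S(2)] by (intro differentiable_divide 1 2) auto
  then show ?thesis
    using that[of e k] e inS kder kder[of _ 0] by force
qed

text \<open>The one-variable test applied to \<open>ln \<rho> - g\<close> along a line through
  \<open>z\<close>. The nested \<open>deriv\<close> is the pure second partial derivative in
  \<open>x\<close> for \<open>d = 1\<close> and in \<open>y\<close> for
  \<open>d = \<i>\<close>.\<close>

lemma second_deriv_ln_le_at_local_max:
  fixes \<rho> g :: "complex \<Rightarrow> real"
  assumes C2: "C2_on S \<rho>" and S: "open S" "z \<in> S" and pos: "\<And>w. w \<in> S \<Longrightarrow> \<rho> w > 0"
    and d: "norm d = 1"
    and r: "r > 0" and max: "\<And>w. w \<in> S \<Longrightarrow> dist w z < r \<Longrightarrow> ln (\<rho> w) - g w \<le> ln (\<rho> z) - g z"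
    and g: "\<And>t. \<bar>t\<bar> < r \<Longrightarrow> ((\<lambda>t. g (z + d * of_real t)) has_real_derivative g' t) (at t)"
    and g': "(g' has_real_derivative D) (at 0)"
  shows "deriv (\<lambda>t::real. deriv (\<lambda>s::real. ln (\<rho> (z + d * of_real t + d * of_real s))) 0) 0 \<le> D"
proof -
  obtain e k where ek: "e > 0" "\<And>t. \<bar>t\<bar> < e \<Longrightarrow> z + d * of_real t \<in> S"
    "\<And>w. w \<in> S \<Longrightarrow> ((\<lambda>t::real. ln (\<rho> (w + d * of_real t))) has_real_derivative k w) (at 0)"
    "\<And>t. \<bar>t\<bar> < e \<Longrightarrow>
        ((\<lambda>t::real. ln (\<rho> (z + d * of_real t))) has_real_derivative k (z + d * of_real t)) (at t)"
    "(\<lambda>t::real. k (z + d * of_real t)) differentiable (at 0)"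
    using C2_on_line_derivs[OF C2 S pos d] by metis
  obtain E where E: "((\<lambda>t::real. k (z + d * of_real t)) has_real_derivative E) (at 0)"
    using ek(5) by (auto simp: real_differentiable_def)
  \<comment> \<open>The inner derivative is known to equal \<open>k\<close> only while the line
    stays in \<open>S\<close>; equality near \<open>0\<close> suffices for the outer
    \<open>deriv\<close>.\<close>
  have "\<forall>\<^sub>F t::real in nhds 0. dist t 0 < e"
    using ek(1) by (auto simp: eventually_nhds_metric)
  then have "\<forall>\<^sub>F t::real in nhds 0.
      deriv (\<lambda>s::real. ln (\<rho> (z + d * of_real t + d * of_real s))) 0 = k (z + d * of_real t)"
    by eventually_elim (auto intro!: DERIV_imp_deriv ek(3) ek(2))
  then have "deriv (\<lambda>t::real. deriv (\<lambda>s::real. ln (\<rho> (z + d * of_real t + d * of_real s))) 0) 0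
      = deriv (\<lambda>t::real. k (z + d * of_real t)) 0"
    by (intro deriv_cong_ev) auto
  also have "\<dots> = E" using E by (rule DERIV_imp_deriv)
  also have "E - D \<le> 0"
  proof (rule local_max_second_deriv_nonpos)
    show "min e r > 0" using ek(1) r by simp
    show "((\<lambda>t. k (z + d * of_real t) - g' t) has_real_derivative E - D) (at 0)"
      by (intro derivative_intros E g')
    show "((\<lambda>t. ln (\<rho> (z + d * of_real t)) - g (z + d * of_real t))
        has_real_derivative k (z + d * of_real t) - g' t) (at t)" if "\<bar>t\<bar> < min e r" for t
      using that by (intro derivative_intros ek(4) g) auto
    show "ln (\<rho> (z + d * of_real t)) - g (z + d * of_real t)
        \<le> ln (\<rho> (z + d * of_real 0)) - g (z + d * of_real 0)" if "\<bar>t\<bar> < min e r" for t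
      using that d by (simp add: max ek(2) dist_norm norm_mult)
  qed
  then have "E \<le> D" by simp
  finally show ?thesis .
qed

text \<open>The maximum bounds the Laplacian of \<open>ln \<rho>\<close> above by that of
  \<open>g\<close>, while the curvature bound makes it at least
  \<open>4 * (\<rho> z)\<^sup>2\<close>. The comparison function \<open>g\<close> enters only
  through its derivatives along the two coordinate lines, which are computed explicitly in each
  application.\<close>

lemma curvature_le_local_max:
  fixes \<rho> g :: "complex \<Rightarrow> real"
  assumes \<rho>: "conformal_pseudometric G \<rho>" "curvature_le G \<rho> (-4)"
    and z: "z \<in> G" "\<rho> z > 0"
    and r: "r > 0"
    and max: "\<And>w. w \<in> G \<Longrightarrow> \<rho> w > 0 \<Longrightarrow> dist w z < r \<Longrightarrow> ln (\<rho> w) - g w \<le> ln (\<rho> z) - g z"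
    and gx: "\<And>t. \<bar>t\<bar> < r \<Longrightarrow> ((\<lambda>t. g (z + of_real t)) has_real_derivative gx t) (at t)"
    and gxx: "(gx has_real_derivative gxx) (at 0)"
    and gy: "\<And>t. \<bar>t\<bar> < r \<Longrightarrow> ((\<lambda>t. g (z + \<i> * of_real t)) has_real_derivative gy t) (at t)"
    and gyy: "(gy has_real_derivative gyy) (at 0)"
  shows "4 * (\<rho> z)\<^sup>2 \<le> gxx + gyy"
proof -
  define S where "S = {z \<in> G. \<rho> z > 0}"
  have G: "open G" "continuous_on G \<rho>" and C2: "C2_on S \<rho>"
    using \<rho>(1) by (auto simp: conformal_pseudometric_def S_def)
  have "S = G \<inter> \<rho> -` {0<..}" by (auto simp: S_def)
  then have S: "open S" "z \<in> S"
    using continuous_open_preimage[OF G(2,1), of "{0<..}"] z by (auto simp: S_def)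
  have pos: "\<rho> w > 0" if "w \<in> S" for w using that by (simp add: S_def)
  have max': "ln (\<rho> w) - g w \<le> ln (\<rho> z) - g z" if "w \<in> S" "dist w z < r" for w
    using max that by (auto simp: S_def)
  have "partial_x (partial_x (\<lambda>w. ln (\<rho> w))) z \<le> gxx"
    using second_deriv_ln_le_at_local_max[OF C2 S pos _ r max', of 1 gx gxx] gx gxx
    by (simp add: partial_x_def)
  moreover have "partial_y (partial_y (\<lambda>w. ln (\<rho> w))) z \<le> gyy"
    using second_deriv_ln_le_at_local_max[OF C2 S pos _ r max', of \<i> gy gyy] gy gyy
    by (simp add: partial_y_def)
  ultimately have "laplacian (\<lambda>w. ln (\<rho> w)) z \<le> gxx + gyy"
    by (simp add: laplacian_def)
  moreover have "4 * (\<rho> z)\<^sup>2 \<le> laplacian (\<lambda>w. ln (\<rho> w)) z"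
    using \<rho>(2) z by (auto simp: curvature_le_def curvature_def field_simps)
  ultimately show ?thesis by simp
qed

section \<open>Ahlfors' lemma\<close>

text \<open>Compare with the Poincare metric \<open>R / (R\<^sup>2 - |z|\<^sup>2)\<close> of a
  smaller disk. It blows up on its boundary circle, so the quotient has an interior maximum; the
  curvature bound there keeps the quotient at most 1. Then let \<open>R\<close> tend to 1.\<close>

lemma Ahlfors_unit_disk:
  assumes \<rho>: "conformal_pseudometric unit_disk \<rho>" "curvature_le unit_disk \<rho> (-4)"
    and a: "a \<in> unit_disk"
  shows "\<rho> a \<le> disk_metric a"
proof -
  have cont: "continuous_on unit_disk \<rho>"
    using \<rho>(1) by (auto simp: conformal_pseudometric_def)
  have le: "\<rho> a * (R\<^sup>2 - (norm a)\<^sup>2) \<le> R" if R: "norm a < R" "R < 1" for R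
  proof (rule ccontr)
    assume a_gt: "\<not> ?thesis"
    have R0: "0 < R" using R norm_ge_zero[of a] by linarith
    define q where "q w = \<rho> w * (R\<^sup>2 - (norm w)\<^sup>2)" for w
    have "continuous_on (cball 0 R) q" unfolding q_def
      using R by (intro continuous_intros continuous_on_subset[OF cont]) auto
    moreover have "cball (0::complex) R \<noteq> {}" using R0 by simp
    ultimately obtain z where z: "norm z \<le> R" and zmax: "\<And>w. norm w \<le> R \<Longrightarrow> q w \<le> q z"
      using continuous_attains_sup[of "cball (0::complex) R" q] by auto
    have qz: "q z > R" using zmax[of a] a_gt R by (auto simp: q_def)
    have "norm z \<noteq> R" using qz R0 by (auto simp: q_def)
    with z have zR: "norm z < R" by simp
    have sq: "(norm w)\<^sup>2 < R\<^sup>2" if "norm w < R" for w :: complex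
      using that by (intro power_strict_mono) auto
    define A where "A = R\<^sup>2 - (norm z)\<^sup>2"
    have A: "A > 0" using sq[OF zR] by (simp add: A_def)
    have \<rho>z: "\<rho> z > 0"
    proof (rule ccontr)
      assume "\<not> \<rho> z > 0"
      then have "q z \<le> 0" using A by (simp add: q_def A_def mult_nonpos_nonneg)
      then show False using qz R0 by simp
    qed
    define r where "r = R - norm z"
    have r: "r > 0" using zR by (simp add: r_def)
    have near: "norm w < R" if "dist w z < r" for w
      using that norm_triangle_ineq[of "w - z" z] by (simp add: r_def dist_norm)
    \<comment> \<open>up to an additive constant, \<open>g\<close> is the logarithm of the Poincare metric of the disk of radius \<open>R\<close>\<close>
    define g where "g w = - ln (R\<^sup>2 - (norm w)\<^sup>2)" for w :: complex
    \<comment> \<open>Here \<open>c\<close> is the inner product of \<open>z\<close> and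
      \<open>d\<close>: it is \<open>Re z\<close> for \<open>d = 1\<close> and \<open>Im z\<close>
      for \<open>d = \<i>\<close>.\<close>
    have line: "((\<lambda>t. g (z + d * of_real t)) has_real_derivative
          2 * (c + t) / (A - 2 * c * t - t\<^sup>2)) (at t)"
      if t: "\<bar>t\<bar> < r" and c: "\<And>t::real. (norm (z + d * of_real t))\<^sup>2 = (norm z)\<^sup>2 + 2 * c * t + t\<^sup>2"
        and d: "norm d = 1" for d c t
    proof -
      have eq: "R\<^sup>2 - (norm (z + d * of_real t))\<^sup>2 = A - 2 * c * t - t\<^sup>2" for t :: real
        by (simp add: c A_def)
      have "norm (z + d * of_real t) < R" using t d by (intro near) (simp add: dist_norm norm_mult)
      from sq[OF this] have "A - 2 * c * t - t\<^sup>2 > 0" using eq[of t] by simp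
      then show ?thesis unfolding g_def eq
        by (auto intro!: derivative_eq_intros simp: field_simps)
    qed
    have line2: "((\<lambda>t. 2 * (c + t) / (A - 2 * c * t - t\<^sup>2)) has_real_derivative
        2 / A + 4 * c\<^sup>2 / A\<^sup>2) (at 0)" for c
      using A by (auto intro!: derivative_eq_intros simp: field_simps power2_eq_square)
    have n: "(norm (z + 1 * of_real t))\<^sup>2 = (norm z)\<^sup>2 + 2 * Re z * t + t\<^sup>2"
      "(norm (z + \<i> * of_real t))\<^sup>2 = (norm z)\<^sup>2 + 2 * Im z * t + t\<^sup>2" for t :: real
      unfolding cmod_power2 by (simp_all add: power2_eq_square algebra_simps)
    have "4 * (\<rho> z)\<^sup>2 \<le> (2 / A + 4 * (Re z)\<^sup>2 / A\<^sup>2) + (2 / A + 4 * (Im z)\<^sup>2 / A\<^sup>2)"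
    proof (rule curvature_le_local_max[OF \<rho> _ \<rho>z r _ _ line2 _ line2])
      show "z \<in> unit_disk" using zR R by simp
      show "((\<lambda>t. g (z + of_real t)) has_real_derivative
          2 * (Re z + t) / (A - 2 * Re z * t - t\<^sup>2)) (at t)" if "\<bar>t\<bar> < r" for t
        using line[OF that n(1)] by simp
      show "((\<lambda>t. g (z + \<i> * of_real t)) has_real_derivative
          2 * (Im z + t) / (A - 2 * Im z * t - t\<^sup>2)) (at t)" if "\<bar>t\<bar> < r" for t
        using line[OF that n(2)] by simp
      show "ln (\<rho> w) - g w \<le> ln (\<rho> z) - g z" if "\<rho> w > 0" "dist w z < r" for w
      proof -
        have "norm w < R" by (rule near[OF that(2)])
        then have "ln (q w) \<le> ln (q z)"
          using zmax[of w] sq[of w] that A by (intro ln_mono) (auto simp: q_def)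
        then show ?thesis
          using sq[OF \<open>norm w < R\<close>] sq[OF zR] that \<rho>z by (simp add: q_def g_def ln_mult)
      qed
    qed
    \<comment> \<open>This says that the comparison metric \<open>R / A\<close> has curvature
      exactly -4.\<close>
    also have "\<dots> = 4 * R\<^sup>2 / A\<^sup>2"
    proof -
      have "R\<^sup>2 = A + (Re z)\<^sup>2 + (Im z)\<^sup>2" by (simp add: A_def cmod_power2)
      then show ?thesis using A by (simp add: field_simps power2_eq_square)
    qed
    finally have "(\<rho> z * A)\<^sup>2 \<le> R\<^sup>2" using A by (simp add: field_simps power_mult_distrib)
    moreover have "R\<^sup>2 < (\<rho> z * A)\<^sup>2" using qz R0 unfolding q_def A_def
      by (intro power_strict_mono) auto
    ultimately show False by simp
  qed
  have "\<rho> a * (1\<^sup>2 - (norm a)\<^sup>2) \<le> 1"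
  proof (rule tendsto_le[of "at_left 1"])
    show "((\<lambda>R. \<rho> a * (R\<^sup>2 - (norm a)\<^sup>2)) \<longlongrightarrow> \<rho> a * (1\<^sup>2 - (norm a)\<^sup>2)) (at_left (1::real))"
      by (intro tendsto_intros)
    show "((\<lambda>R. R) \<longlongrightarrow> 1) (at_left (1::real))" by (rule tendsto_ident_at)
    show "\<forall>\<^sub>F R in at_left 1. \<rho> a * (R\<^sup>2 - (norm a)\<^sup>2) \<le> R"
      using a le by (auto simp: eventually_at_left_field intro!: exI[of _ "norm a"])
  qed simp
  moreover have "1 - (norm a)\<^sup>2 > 0" using a by (simp add: power_less_one_iff abs_square_less_1)
  ultimately show ?thesis by (simp add: disk_metric_def field_simps)
qed

section \<open>The Hopf-type barrier\<close>

text \<open>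
  For \<open>\<psi> = M\<^sup>2 exp (- K |z - a|\<^sup>2)\<close> with \<open>M = 1 - |z|\<^sup>2\<close>, the inequality below is
  \<open>\<Delta> \<psi> \<ge> 8 \<psi> / M\<^sup>2\<close> divided by \<open>4 M exp (- K |z - a|\<^sup>2)\<close>. Near the circle the inner product is
  bounded below by a positive constant; elsewhere the term in \<open>K\<^sup>2\<close> dominates.
\<close>
lemma barrier_constant:
  fixes a :: complex
  assumes a: "norm a < 1" and \<delta>: "\<delta> > 0"
  obtains K where "K > 0" "\<And>z. norm z < 1 \<Longrightarrow> norm (z - a) \<ge> \<delta> \<Longrightarrow>
    4 + K * (1 - (norm z)\<^sup>2) \<le> 4 * K * (z \<bullet> (z - a)) + K\<^sup>2 * (1 - (norm z)\<^sup>2) * (norm (z - a))\<^sup>2"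
proof -
  define r where "r = (1 + norm a) / 2"
  have r: "0 < r" "r < 1" "norm a < r" using a by (auto simp: r_def add_pos_nonneg)
  define \<eta> where "\<eta> = r * (r - norm a)"
  have \<eta>: "\<eta> > 0" using r by (simp add: \<eta>_def)
  define m where "m = 1 - r\<^sup>2"
  have m: "m > 0" using r by (simp add: m_def power_less_one_iff)
  \<comment> \<open>For \<open>norm z \<ge> r\<close> the inner product is at least
    \<open>\<eta>\<close>: the second entry absorbs the summand 4, and the third absorbs
    \<open>K * (1 - (norm z)\<^sup>2)\<close>. For \<open>norm z < r\<close> the inner product is at
    least -2, so the quadratic term has to cover \<open>4 * K + K + 8 * K = 13 * K\<close>, whence
    the last entry.\<close>
  define K where "K = Max {1, 1 / \<eta>, 1 / \<delta>\<^sup>2, 13 / (m * \<delta>\<^sup>2)}"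
  have "1 \<le> K" "1 / \<eta> \<le> K" "1 / \<delta>\<^sup>2 \<le> K" "13 / (m * \<delta>\<^sup>2) \<le> K"
    unfolding K_def by (rule Max_ge; simp)+
  then have K: "K \<ge> 1" "K * \<eta> \<ge> 1" "K * \<delta>\<^sup>2 \<ge> 1" "K * (m * \<delta>\<^sup>2) \<ge> 13"
    using \<eta> \<delta> m by (auto simp: field_simps)
  show ?thesis
  proof (rule that[of K])
    show "K > 0" using K by simp
    fix z assume z: "norm z < 1" "norm (z - a) \<ge> \<delta>"
    define A where "A = 1 - (norm z)\<^sup>2"
    have A: "A > 0" "A \<le> 1" using z by (auto simp: A_def power_less_one_iff abs_square_less_1)
    have dist: "\<delta>\<^sup>2 \<le> (norm (z - a))\<^sup>2" using z \<delta> by (intro power_mono) auto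
    have quad: "K\<^sup>2 * A * \<delta>\<^sup>2 \<le> K\<^sup>2 * A * (norm (z - a))\<^sup>2"
      using dist A by (intro mult_left_mono) auto
    show "4 + K * (1 - (norm z)\<^sup>2) \<le> 4 * K * (z \<bullet> (z - a)) + K\<^sup>2 * (1 - (norm z)\<^sup>2) * (norm (z - a))\<^sup>2"
    proof (cases "norm z \<ge> r")
      case True
      have "\<eta> \<le> norm z * (norm z - norm a)"
        unfolding \<eta>_def using True r by (intro mult_mono) auto
      also have "\<dots> \<le> z \<bullet> (z - a)"
        using norm_cauchy_schwarz[of z a] by (simp add: algebra_simps dot_square_norm power2_eq_square)
      finally have "K * \<eta> \<le> K * (z \<bullet> (z - a))" using K by (intro mult_left_mono) auto
      moreover have "K * A * 1 \<le> K * A * (K * \<delta>\<^sup>2)" using K A by (intro mult_left_mono) auto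
      then have "K * A \<le> K\<^sup>2 * A * \<delta>\<^sup>2" by (simp add: power2_eq_square mult_ac)
      ultimately show ?thesis using K(2) quad unfolding A_def by linarith
    next
      case False
      have "(norm z)\<^sup>2 \<le> r\<^sup>2" using False by (intro power_mono) auto
      then have "m \<le> A" by (simp add: m_def A_def)
      have "norm (z - a) \<le> 2" using norm_triangle_ineq4[of z a] z a by linarith
      then have "norm z * norm (z - a) \<le> 1 * 2" using z by (intro mult_mono) auto
      then have "- 2 \<le> z \<bullet> (z - a)" using Cauchy_Schwarz_ineq2[of z "z - a"] by linarith
      then have "K * (- 2) \<le> K * (z \<bullet> (z - a))" using K by (intro mult_left_mono) auto
      moreover have "K * 13 \<le> K * (K * (m * \<delta>\<^sup>2))" using K by (intro mult_left_mono) auto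
      then have "13 * K \<le> K\<^sup>2 * \<delta>\<^sup>2 * m" by (simp only: power2_eq_square mult_ac)
      moreover have "K\<^sup>2 * \<delta>\<^sup>2 * m \<le> K\<^sup>2 * \<delta>\<^sup>2 * A" using \<open>m \<le> A\<close> by (intro mult_left_mono) auto
      moreover have "K * A \<le> K * 1" using A K by (intro mult_left_mono) auto
      ultimately show ?thesis using K(1) quad unfolding A_def
        by (simp only: mult_ac)
    qed
  qed
qed

text \<open>This is \<open>v \<ge> \<epsilon> * \<psi>\<close> outside the small disk, in
  exponential form so that zeros of \<open>\<rho>\<close> are allowed. If it failed,
  \<open>q = \<rho> * M * exp (\<epsilon> * \<psi>)\<close> would have an interior maximum above 1,
  where the curvature bound and the barrier inequality force \<open>q \<le> 1\<close>.\<close>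

lemma barrier_bound:
  assumes \<rho>: "conformal_pseudometric unit_disk \<rho>" "curvature_le unit_disk \<rho> (-4)"
    and a: "norm a < 1" and \<delta>: "\<delta> > 0" and \<epsilon>: "\<epsilon> > 0" and K: "K > 0"
    and barrier: "\<And>z. norm z < 1 \<Longrightarrow> norm (z - a) \<ge> \<delta> \<Longrightarrow>
    4 + K * (1 - (norm z)\<^sup>2) \<le> 4 * K * (z \<bullet> (z - a)) + K\<^sup>2 * (1 - (norm z)\<^sup>2) * (norm (z - a))\<^sup>2"
    and gap: "\<And>z. norm z < 1 \<Longrightarrow> norm (z - a) = \<delta> \<Longrightarrow> \<rho> z * (1 - (norm z)\<^sup>2) \<le> exp (- \<epsilon>)"
    and w: "norm w < 1" "norm (w - a) \<ge> \<delta>"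
  shows "\<rho> w * (1 - (norm w)\<^sup>2) \<le> exp (- \<epsilon> * ((1 - (norm w)\<^sup>2)\<^sup>2 * exp (- K * (norm (w - a))\<^sup>2)))"
proof (rule ccontr)
  assume neg: "\<not> ?thesis"
  have cont: "continuous_on unit_disk \<rho>" and nn: "\<And>z. norm z < 1 \<Longrightarrow> 0 \<le> \<rho> z"
    using \<rho>(1) by (auto simp: conformal_pseudometric_def)
  define M where "M z = 1 - (norm z)\<^sup>2" for z :: complex
  define \<psi> where "\<psi> z = (M z)\<^sup>2 * exp (- K * (norm (z - a))\<^sup>2)" for z
  define q where "q z = \<rho> z * M z * exp (\<epsilon> * \<psi> z)" for z
  have M: "0 < M z" "M z \<le> 1" if "norm z < 1" for z
    using that by (auto simp: M_def power_less_one_iff abs_square_less_1)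
  have \<psi>M: "\<psi> z \<le> (M z)\<^sup>2" for z
    unfolding \<psi>_def using K by (intro mult_left_le) auto
  have \<rho>M: "\<rho> z * M z \<le> 1" if "norm z < 1" for z
    using Ahlfors_unit_disk[OF \<rho>, of z] that M[OF that] by (simp add: M_def disk_metric_def field_simps)
  have qw: "q w > 1"
    using neg unfolding q_def \<psi>_def M_def not_le by (simp add: exp_minus field_simps)
  \<comment> \<open>By Ahlfors' lemma \<open>q\<close> is at most a quantity tending to 1 at the
    unit circle. So on a circle of radius \<open>s\<close> close to 1 it stays below
    \<open>q w > 1\<close>, although \<open>\<rho>\<close> has no assumed boundary values.\<close>
  have q_le: "q z \<le> exp (\<epsilon> * (M z)\<^sup>2)" if "norm z < 1" for z
  proof -
    have "q z \<le> 1 * exp (\<epsilon> * \<psi> z)"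
      unfolding q_def using \<rho>M[OF that] by (intro mult_right_mono) auto
    also have "\<dots> \<le> exp (\<epsilon> * (M z)\<^sup>2)" using \<psi>M[of z] \<epsilon> by simp
    finally show ?thesis .
  qed
  have "((\<lambda>s. exp (\<epsilon> * (1 - s\<^sup>2)\<^sup>2)) \<longlongrightarrow> exp (\<epsilon> * (1 - 1\<^sup>2)\<^sup>2)) (at_left (1::real))"
    by (intro tendsto_intros)
  then have "\<forall>\<^sub>F s in at_left (1::real). exp (\<epsilon> * (1 - s\<^sup>2)\<^sup>2) < q w"
    using qw by (intro order_tendstoD) auto
  moreover have "\<forall>\<^sub>F s in at_left 1. norm w < s \<and> s < 1"
    using w by (auto simp: eventually_at_left_field intro!: exI[of _ "norm w"])
  ultimately have "\<forall>\<^sub>F s in at_left (1::real). exp (\<epsilon> * (1 - s\<^sup>2)\<^sup>2) < q w \<and> norm w < s \<and> s < 1"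
    by (rule eventually_conj)
  then obtain s where s: "exp (\<epsilon> * (1 - s\<^sup>2)\<^sup>2) < q w" "norm w < s" "s < 1"
    using eventually_happens trivial_limit_at_left_real by blast
  define C where "C = cball 0 s - ball a \<delta>"
  have "compact C" unfolding C_def by (intro compact_diff) auto
  moreover have "w \<in> C" using s w by (simp add: C_def dist_norm norm_minus_commute)
  moreover have "continuous_on C q" unfolding q_def \<psi>_def M_def C_def
    using s by (intro continuous_intros continuous_on_subset[OF cont]) auto
  ultimately obtain z where z: "z \<in> C" and zmax: "\<And>u. u \<in> C \<Longrightarrow> q u \<le> q z"
    using continuous_attains_sup[of C q] by auto
  have qz: "q z \<ge> q w" using zmax \<open>w \<in> C\<close> by simp
  have z1: "norm z < 1" "norm z \<le> s" "norm (z - a) \<ge> \<delta>"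
    using z s by (auto simp: C_def dist_norm norm_minus_commute)
  have "norm z \<noteq> s"
  proof
    assume "norm z = s"
    then show False using q_le[OF z1(1)] s(1) qz by (simp add: M_def)
  qed
  \<comment> \<open>On the inner circle the gap \<open>exp (- \<epsilon>)\<close> outweighs
    \<open>exp (\<epsilon> * \<psi>)\<close>, because \<open>\<psi> \<le> 1\<close>.\<close>
  moreover have "norm (z - a) \<noteq> \<delta>"
  proof
    assume "norm (z - a) = \<delta>"
    then have "q z \<le> exp (- \<epsilon>) * exp (\<epsilon> * \<psi> z)"
      unfolding q_def M_def using gap z1 by (intro mult_right_mono) auto
    also have "\<dots> = exp (\<epsilon> * (\<psi> z - 1))" by (simp add: exp_add[symmetric] algebra_simps)
    also have "\<psi> z \<le> 1" using \<psi>M[of z] M[OF z1(1)] power_le_one[of "M z" 2] by linarith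
    then have "exp (\<epsilon> * (\<psi> z - 1)) \<le> 1" using \<epsilon> by (simp add: mult_nonneg_nonpos)
    finally show False using qz qw by simp
  qed
  ultimately have zin: "norm z < s" "norm (z - a) > \<delta>" using z1 by auto
  define r where "r = min (s - norm z) (norm (z - a) - \<delta>)"
  have r: "r > 0" using zin by (simp add: r_def)
  have near: "u \<in> C" if "dist u z < r" for u
  proof -
    have "norm u \<le> s" using that norm_triangle_ineq[of "u - z" z] by (simp add: r_def dist_norm)
    moreover have "norm (u - a) \<ge> \<delta>"
      using that norm_triangle_ineq[of "z - u" "u - a"] by (simp add: r_def dist_norm norm_minus_commute)
    ultimately show ?thesis by (simp add: C_def dist_norm norm_minus_commute)
  qed
  have C1: "norm u < 1" if "u \<in> C" for u using that s by (simp add: C_def)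
  define A where "A = M z"
  define B where "B = (norm (z - a))\<^sup>2"
  have A: "A > 0" using M z1 by (simp add: A_def)
  have \<rho>z: "\<rho> z > 0"
  proof (rule ccontr)
    assume "\<not> \<rho> z > 0"
    then have "\<rho> z = 0" using nn[OF z1(1)] by simp
    then show False using qz qw by (simp add: q_def)
  qed
  \<comment> \<open>Chosen so that \<open>ln \<rho> - g = ln q\<close> wherever
    \<open>\<rho>\<close> is positive.\<close>
  define g where "g u = - ln (M u) - \<epsilon> * \<psi> u" for u
  \<comment> \<open>\<open>g'\<close> is the derivative of \<open>g\<close> along
    \<open>z + d * t\<close>, and \<open>g''\<close> its second derivative at \<open>t = 0\<close>;
    \<open>c\<close> and \<open>c'\<close> are the inner products of \<open>z\<close> and of
    \<open>z - a\<close> with \<open>d\<close>.\<close>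
  define g' where "g' c c' t = 2 * (c + t) / (A - 2 * c * t - t\<^sup>2) +
      \<epsilon> * (4 * (A - 2 * c * t - t\<^sup>2) * (c + t) + 2 * K * (A - 2 * c * t - t\<^sup>2)\<^sup>2 * (c' + t)) *
        exp (- K * (B + 2 * c' * t + t\<^sup>2))" for c c' t
  define g'' where "g'' c c' = 2 / A + 4 * c\<^sup>2 / A\<^sup>2 + \<epsilon> * exp (- K * B) *
      (4 * A - 8 * c\<^sup>2 + 2 * K * A\<^sup>2 - 16 * K * A * c * c' - 4 * K\<^sup>2 * A\<^sup>2 * c'\<^sup>2)" for c c'
  have line: "((\<lambda>t. g (z + d * of_real t)) has_real_derivative g' c c' t) (at t)"
    if t: "\<bar>t\<bar> < r" and d: "norm d = 1"
      and c: "\<And>t::real. (norm (z + d * of_real t))\<^sup>2 = (norm z)\<^sup>2 + 2 * c * t + t\<^sup>2"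
      and c': "\<And>t::real. (norm (z + d * of_real t - a))\<^sup>2 = B + 2 * c' * t + t\<^sup>2" for d c c' t
  proof -
    have eq: "M (z + d * of_real t) = A - 2 * c * t - t\<^sup>2" for t :: real
      by (simp add: c A_def M_def)
    have "norm (z + d * of_real t) < 1" using t d by (intro C1 near) (simp add: dist_norm norm_mult)
    from M(1)[OF this] have "A - 2 * c * t - t\<^sup>2 > 0" using eq[of t] by simp
    then show ?thesis unfolding g_def \<psi>_def eq c' g'_def
      by (auto intro!: derivative_eq_intros simp: field_simps power2_eq_square)
  qed
  have line2: "(g' c c' has_real_derivative g'' c c') (at 0)" for c c'
    unfolding g'_def g''_def using A
    by (auto intro!: derivative_eq_intros simp: field_simps power2_eq_square)
  have n: "(norm (z + 1 * of_real t))\<^sup>2 = (norm z)\<^sup>2 + 2 * Re z * t + t\<^sup>2"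
    "(norm (z + \<i> * of_real t))\<^sup>2 = (norm z)\<^sup>2 + 2 * Im z * t + t\<^sup>2"
    "(norm (z + 1 * of_real t - a))\<^sup>2 = B + 2 * Re (z - a) * t + t\<^sup>2"
    "(norm (z + \<i> * of_real t - a))\<^sup>2 = B + 2 * Im (z - a) * t + t\<^sup>2" for t :: real
    unfolding cmod_power2 B_def by (simp_all add: power2_eq_square algebra_simps)
  have "4 * (\<rho> z)\<^sup>2 \<le> g'' (Re z) (Re (z - a)) + g'' (Im z) (Im (z - a))"
  proof (rule curvature_le_local_max[OF \<rho> _ \<rho>z r _ _ line2 _ line2])
    show "z \<in> unit_disk" using z1 by simp
    show "((\<lambda>t. g (z + of_real t)) has_real_derivative g' (Re z) (Re (z - a)) t) (at t)"
      if "\<bar>t\<bar> < r" for t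
      using line[OF that _ n(1,3)] by simp
    show "((\<lambda>t. g (z + \<i> * of_real t)) has_real_derivative g' (Im z) (Im (z - a)) t) (at t)"
      if "\<bar>t\<bar> < r" for t
      using line[OF that _ n(2,4)] by simp
    show "ln (\<rho> u) - g u \<le> ln (\<rho> z) - g z" if "\<rho> u > 0" "dist u z < r" for u
    proof -
      have u: "u \<in> C" by (rule near[OF that(2)])
      then have "ln (q u) \<le> ln (q z)"
        using zmax[OF u] M(1)[OF C1[OF u]] that by (intro ln_mono) (auto simp: q_def)
      then show ?thesis
        using M(1)[OF C1[OF u]] M(1)[OF z1(1)] that \<rho>z by (simp add: q_def g_def ln_mult)
    qed
  qed
  \<comment> \<open>The Laplacian of \<open>g\<close>: \<open>4 / A\<^sup>2\<close> comes from the
    Poincare metric, and the bracket times \<open>exp (- K * B)\<close> is minus the Laplacian of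
    \<open>\<psi>\<close>.\<close>
  also have "\<dots> = 4 / A\<^sup>2 + \<epsilon> * exp (- K * B) *
     (16 * A - 8 + 4 * K * A\<^sup>2 - 16 * K * A * (z \<bullet> (z - a)) - 4 * K\<^sup>2 * A\<^sup>2 * B)"
  proof -
    have ip: "z \<bullet> (z - a) = Re z * Re (z - a) + Im z * Im (z - a)" by (simp add: inner_complex_def)
    have B: "B = (Re (z - a))\<^sup>2 + (Im (z - a))\<^sup>2" by (simp add: B_def cmod_power2)
    have n: "(Re z)\<^sup>2 + (Im z)\<^sup>2 = 1 - A" by (simp add: A_def M_def cmod_power2)
    have "2 / A + 4 * (Re z)\<^sup>2 / A\<^sup>2 + (2 / A + 4 * (Im z)\<^sup>2 / A\<^sup>2) = 4 / A + 4 * ((Re z)\<^sup>2 + (Im z)\<^sup>2) / A\<^sup>2"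
      by (simp add: add_divide_distrib algebra_simps)
    also have "\<dots> = 4 / A\<^sup>2" unfolding n using A by (simp add: field_simps power2_eq_square)
    finally have 1: "2 / A + 4 * (Re z)\<^sup>2 / A\<^sup>2 + (2 / A + 4 * (Im z)\<^sup>2 / A\<^sup>2) = 4 / A\<^sup>2" .
    have 2: "(4 * A - 8 * (Re z)\<^sup>2 + 2 * K * A\<^sup>2 - 16 * K * A * Re z * Re (z - a) - 4 * K\<^sup>2 * A\<^sup>2 * (Re (z - a))\<^sup>2)
      + (4 * A - 8 * (Im z)\<^sup>2 + 2 * K * A\<^sup>2 - 16 * K * A * Im z * Im (z - a) - 4 * K\<^sup>2 * A\<^sup>2 * (Im (z - a))\<^sup>2)
      = 16 * A - 8 + 4 * K * A\<^sup>2 - 16 * K * A * (z \<bullet> (z - a)) - 4 * K\<^sup>2 * A\<^sup>2 * ((Re (z - a))\<^sup>2 + (Im (z - a))\<^sup>2)"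
      using n unfolding ip by algebra
    show ?thesis
      unfolding g''_def 1[symmetric] B[symmetric] 2[symmetric, folded B] by (simp only: distrib_left add_ac)
  qed
  \<comment> \<open>The barrier inequality times \<open>4 * A\<close>; since
    \<open>\<psi> z = A\<^sup>2 * exp (- K * B)\<close>, it says that the Laplacian of
    \<open>\<psi>\<close> is at least \<open>8 * \<psi> / A\<^sup>2\<close>.\<close>
  also have "\<dots> \<le> 4 / A\<^sup>2 + \<epsilon> * exp (- K * B) * (- 8)"
  proof -
    have "4 + K * A \<le> 4 * K * (z \<bullet> (z - a)) + K\<^sup>2 * A * B"
      using barrier[OF z1(1,3)] by (simp add: A_def M_def B_def)
    then have "4 * A * (4 + K * A) \<le> 4 * A * (4 * K * (z \<bullet> (z - a)) + K\<^sup>2 * A * B)"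
      using A by (intro mult_left_mono) auto
    then have "16 * A - 8 + 4 * K * A\<^sup>2 - 16 * K * A * (z \<bullet> (z - a)) - 4 * K\<^sup>2 * A\<^sup>2 * B \<le> - 8"
      by (simp add: algebra_simps power2_eq_square)
    then show ?thesis using \<epsilon> by (intro add_left_mono mult_left_mono) auto
  qed
  finally have "(\<rho> z)\<^sup>2 * A\<^sup>2 \<le> 1 - 2 * \<epsilon> * \<psi> z"
    using A by (simp add: \<psi>_def A_def[symmetric] B_def[symmetric] field_simps)
  \<comment> \<open>Passing from the linear bound to the exponential turns the estimate into
    \<open>(q z)\<^sup>2 \<le> 1\<close>.\<close>
  also have "\<dots> \<le> exp (- 2 * \<epsilon> * \<psi> z)" using exp_ge_add_one_self[of "- 2 * \<epsilon> * \<psi> z"] by simp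
  finally have "(\<rho> z)\<^sup>2 * A\<^sup>2 * exp (2 * \<epsilon> * \<psi> z) \<le> 1"
    by (simp add: exp_minus field_simps)
  moreover have "(q z)\<^sup>2 = (\<rho> z)\<^sup>2 * A\<^sup>2 * exp (2 * \<epsilon> * \<psi> z)"
    by (simp add: q_def A_def power_mult_distrib exp_double[symmetric] mult.assoc)
  moreover have "(q z)\<^sup>2 > 1" using qz qw by (intro one_less_power) auto
  ultimately show False by simp
qed

section \<open>Boundary rigidity: the barrier against the asymptotics\<close>

theorem theorem2p6:
  fixes \<rho> :: "complex \<Rightarrow> real" and z :: "nat \<Rightarrow> complex"
  assumes "conformal_pseudometric unit_disk \<rho>"
    and "curvature_le unit_disk \<rho> (-4)"
    and "\<And>n. z n \<in> unit_disk"
    and "(\<lambda>n. norm (z n)) \<longlonglongrightarrow> 1"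
    and "(\<lambda>n. \<rho> (z n) / disk_metric (z n) - 1) \<in> o(\<lambda>n. (1 - norm (z n))\<^sup>2)"
  shows "\<forall>w\<in>unit_disk. \<rho> w = disk_metric w"
proof (rule ccontr)
  assume "\<not> ?thesis"
  then obtain a where a: "norm a < 1" "\<rho> a < disk_metric a"
    using Ahlfors_unit_disk[OF assms(1,2)] by force
  have cont: "continuous_on unit_disk \<rho>"
    using assms(1) by (auto simp: conformal_pseudometric_def)
  define m where "m w = \<rho> w * (1 - (norm w)\<^sup>2)" for w
  have m_eq: "m w = \<rho> w / disk_metric w" for w by (simp add: m_def disk_metric_def)
  have "0 < 1 - (norm a)\<^sup>2" using a by (simp add: power_less_one_iff abs_square_less_1)
  then have "m a < 1" using a by (simp add: m_def disk_metric_def field_simps)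
  \<comment> \<open>Positivity of \<open>c\<close> is secured separately because \<open>m a\<close>
    may be 0, and \<open>\<epsilon> = - ln c\<close> is wanted.\<close>
  then obtain c where c: "m a < c" "c < 1" "c > 0" using dense[of "max 0 (m a)" 1] by auto
  define \<epsilon> where "\<epsilon> = - ln c"
  have \<epsilon>: "\<epsilon> > 0" "exp (- \<epsilon>) = c" using c by (auto simp: \<epsilon>_def)
  have "continuous_on unit_disk m" unfolding m_def by (intro continuous_intros cont)
  then have "isCont m a" using a by (simp add: continuous_on_eq_continuous_at)
  then have "\<forall>\<^sub>F w in nhds a. m w < c"
    using c by (intro order_tendstoD[of m "m a"]) (simp_all add: continuous_at tendsto_at_iff_tendsto_nhds)
  then obtain d where d: "d > 0" "\<And>w. dist w a < d \<Longrightarrow> m w < c"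
    by (auto simp: eventually_nhds_metric)
  \<comment> \<open>Below \<open>d\<close>, so that the gap holds on the circle around
    \<open>a\<close>; below \<open>1 - norm a\<close>, so that \<open>z n\<close> eventually leaves
    the disk it bounds.\<close>
  define \<delta> where "\<delta> = min d (1 - norm a) / 2"
  have \<delta>: "\<delta> > 0" "\<delta> < d" "\<delta> < 1 - norm a" using d a by (auto simp: \<delta>_def)
  obtain K where K: "K > 0" "\<And>z. norm z < 1 \<Longrightarrow> norm (z - a) \<ge> \<delta> \<Longrightarrow>
    4 + K * (1 - (norm z)\<^sup>2) \<le> 4 * K * (z \<bullet> (z - a)) + K\<^sup>2 * (1 - (norm z)\<^sup>2) * (norm (z - a))\<^sup>2"
    using barrier_constant[OF a(1) \<delta>(1)] by blast
  have gap: "\<rho> w * (1 - (norm w)\<^sup>2) \<le> exp (- \<epsilon>)" if "norm (w - a) = \<delta>" for w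
    using d(2)[of w] that \<delta> \<epsilon> by (simp add: m_def dist_norm)
  \<comment> \<open>As \<open>norm (w - a) \<le> 2\<close> and
    \<open>1 - (norm w)\<^sup>2 \<ge> 1 - norm w\<close>, the barrier
    \<open>\<epsilon> * \<psi>\<close> is at least
    \<open>\<kappa> * (1 - norm w)\<^sup>2\<close>.\<close>
  define \<kappa> where "\<kappa> = \<epsilon> * exp (- K * 4)"
  have \<kappa>: "\<kappa> > 0" using \<epsilon> by (simp add: \<kappa>_def)
  have bound: "m w \<le> exp (- (\<kappa> * (1 - norm w)\<^sup>2))" if w: "norm w < 1" "norm (w - a) \<ge> \<delta>" for w
  proof -
    have "norm (w - a) \<le> 2" using norm_triangle_ineq4[of w a] w a by linarith
    then have "(norm (w - a))\<^sup>2 \<le> 2\<^sup>2" by (intro power_mono) auto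
    then have "exp (- K * 4) \<le> exp (- K * (norm (w - a))\<^sup>2)" using K(1) by simp
    moreover have "(norm w)\<^sup>2 \<le> norm w" using w by (simp add: power2_eq_square mult_left_le)
    then have "(1 - norm w)\<^sup>2 \<le> (1 - (norm w)\<^sup>2)\<^sup>2" using w by (intro power_mono) auto
    ultimately have "(1 - norm w)\<^sup>2 * exp (- K * 4) \<le> (1 - (norm w)\<^sup>2)\<^sup>2 * exp (- K * (norm (w - a))\<^sup>2)"
      by (intro mult_mono) auto
    then have "\<kappa> * (1 - norm w)\<^sup>2 \<le> \<epsilon> * ((1 - (norm w)\<^sup>2)\<^sup>2 * exp (- K * (norm (w - a))\<^sup>2))"
      using \<epsilon>(1) unfolding \<kappa>_def by (simp add: mult_ac)
    then show ?thesis
      using barrier_bound[OF assms(1,2) a(1) \<delta>(1) \<epsilon>(1) K gap w] unfolding m_def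
      by (smt (verit) exp_le_cancel_iff mult_minus_left)
  qed
  \<comment> \<open>The factor 1/4 leaves room for
    \<open>exp (- x) \<le> 1 / (1 + x) < 1 - x / 4\<close> on \<open>0 < x < 1\<close>, which
    contradicts this bound at \<open>x = \<kappa> * (1 - norm (z n))\<^sup>2\<close>.\<close>
  have "\<forall>\<^sub>F n in sequentially. norm (\<rho> (z n) / disk_metric (z n) - 1) \<le> \<kappa> / 4 * norm ((1 - norm (z n))\<^sup>2)"
    using landau_o.smallD[OF assms(5), of "\<kappa> / 4"] \<kappa> by simp
  moreover have "\<forall>\<^sub>F n in sequentially. norm (z n) > norm a + \<delta>"
    using \<delta> by (intro order_tendstoD[OF assms(4)]) auto
  moreover have "(\<lambda>n. \<kappa> * (1 - norm (z n))\<^sup>2) \<longlonglongrightarrow> \<kappa> * (1 - 1)\<^sup>2"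
    by (intro tendsto_intros assms(4))
  then have "\<forall>\<^sub>F n in sequentially. \<kappa> * (1 - norm (z n))\<^sup>2 < 1"
    by (rule order_tendstoD) simp
  ultimately have "\<forall>\<^sub>F n in sequentially. False"
  proof eventually_elim
    case (elim n)
    define x where "x = \<kappa> * (1 - norm (z n))\<^sup>2"
    have zn: "norm (z n) < 1" using assms(3)[of n] by simp
    have x: "0 < x" "x < 1" using zn \<kappa> elim by (auto simp: x_def)
    have "norm (z n - a) \<ge> \<delta>" using norm_triangle_ineq2[of "z n" a] elim by linarith
    then have "m (z n) \<le> exp (- x)" using bound zn by (simp add: x_def)
    also have "\<dots> \<le> 1 / (1 + x)"
      using exp_ge_add_one_self[of x] x by (simp add: exp_minus field_simps)
    also have "\<dots> < 1 - x / 4"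
    proof -
      have "x * x < x * 1" using x by (intro mult_strict_left_mono) auto
      then show ?thesis using x by (simp add: field_simps)
    qed
    finally have "m (z n) < 1 - x / 4" .
    moreover have "\<bar>m (z n) - 1\<bar> \<le> x / 4" using elim(1) by (simp add: m_eq x_def)
    ultimately show False by linarith
  qed
  then show False by simp
qed

end
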